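(* Let $\|\cdot\|$ be a norm on $\mathbb{R}^2$. Let $n\ge 3$ be an odd integer and let $v_1,v_2,\ldots,v_n\in\mathbb{R}^2$ be vectors, not necessarily distinct, with $\|v_i\|=1$ for every $i\in\{1,\ldots,n\}$. If there is a non-zero vector $u\in\mathbb{R}^2$ such that $u\cdot v_i\ge 0$ for every $i\in\{1,\ldots,n\}$, then $$\|v_1+v_2+\cdots+v_n\|\ge 1.$$
   Context: The norm $\|\cdot\|$ on $\mathbb{R}^2$ is arbitrary (not necessarily Euclidean or strictly convex). A unit vector is a vector of norm $1$ in this norm, whereas $u\cdot v$ denotes the usual (Euclidean) scalar product on $\mathbb{R}^2$. The family $v_1,\ldots,v_n$ is regarded as a sequence (multiset): $v_i=v_j$ is allowed for $i\ne j$. *)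

theory Defs
  imports "HOL-Analysis.Analysis"
begin

(* The library's norm is tied to the type (on real^2 it is the Euclidean one),
   so a norm that is arbitrary has to be a function on the vector space. *)
definition is_norm :: "('a::real_vector \<Rightarrow> real) \<Rightarrow> bool" where
  "is_norm N \<longleftrightarrow>
     (\<forall>x. N x \<ge> 0) \<and>
     (\<forall>x. N x = 0 \<longleftrightarrow> x = 0) \<and>
     (\<forall>c x. N (c *\<^sub>R x) = \<bar>c\<bar> * N x) \<and>
     (\<forall>x y. N (x + y) \<le> N x + N y)"

end

theory Submission
  imports Defs
begin

text \<open>
  Order the vectors by direction. Since they all lie in the half-plane
  \<open>u \<bullet> x \<ge> 0\<close> and their number is odd, there is a middle vector \<open>m\<close>. Let \<open>f\<close> be a
  supporting functional of the unit ball at \<open>m\<close>: it is linear, \<open>f x \<le> N x\<close> for all \<open>x\<close>,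
  and \<open>f m = 1\<close>. As \<open>N s \<ge> f s\<close> for the sum \<open>s\<close>, it is enough that \<open>f s \<ge> 1\<close>. The
  middle vector contributes exactly \<open>1\<close> to \<open>f s\<close>, and the remaining vectors are matched
  symmetrically about the middle of the order. So everything reduces to one claim: if
  \<open>m\<close> lies between \<open>b\<close> and \<open>a\<close> in the half-plane, then \<open>f a + f b \<ge> 0\<close>
  (\<open>support_sum_nonneg_of_between\<close>).

  The geometric reason for the claim is that \<open>f\<close> decreases along the unit circle from \<open>m\<close>
  to \<open>- m\<close> on either side. The angle from \<open>b\<close> to \<open>a\<close> is at most \<open>\<pi>\<close>, so \<open>b\<close> is met no later
  than \<open>- a\<close> on the way from \<open>m\<close> to \<open>- m\<close>, whence \<open>f b \<ge> f (- a)\<close>. The proof replaces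
  the circle by the relation \<open>D *\<^sub>R m = A *\<^sub>R a + B *\<^sub>R b\<close> with nonnegative coefficients, which
  Cramer's rule supplies, and the triangle inequality (\<open>support_sum_nonneg_of_cone\<close>).
\<close>

section \<open>Supporting functionals of a norm\<close>

lemma is_norm_minus: "is_norm N \<Longrightarrow> N (- x) = N x"
  unfolding is_norm_def by (metis abs_1 abs_minus_cancel mult_1 scaleR_minus1_left)

lemma convex_norm_ball:
  assumes "is_norm N"
  shows "convex {x. N x < 1}"
proof (rule convexI)
  fix x y and s t :: real
  assume xy: "x \<in> {x. N x < 1}" "y \<in> {x. N x < 1}" and st: "0 \<le> s" "0 \<le> t" "s + t = 1"
  have "N (s *\<^sub>R x + t *\<^sub>R y) \<le> s * N x + t * N y"
    using assms st unfolding is_norm_def by (metis abs_of_nonneg)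
  also have "\<dots> < 1"
    using convex_bound_lt[of "N x" 1 "N y" s t] xy st by simp
  finally show "s *\<^sub>R x + t *\<^sub>R y \<in> {x. N x < 1}" by simp
qed

text \<open>
  The Hahn-Banach theorem in finite dimension: a hyperplane separates the open unit ball from
  \<open>m\<close>, and its normal vector, rescaled to the value \<open>1\<close> at \<open>m\<close>, is \<open>w\<close>.
\<close>
lemma supporting_functional_exists:
  fixes N :: "'a::euclidean_space \<Rightarrow> real"
  assumes N: "is_norm N" and m: "N m = 1"
  obtains w where "\<And>x. w \<bullet> x \<le> N x" and "w \<bullet> m = 1"
proof -
  have N0: "N 0 = 0" using N by (simp add: is_norm_def)
  have "convex {x. N x < 1}" by (rule convex_norm_ball[OF N])
  moreover have "{x. N x < 1} \<noteq> {}" using N0 by (auto intro!: exI[of _ 0])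
  moreover have "{x. N x < 1} \<inter> {m} = {}" using m by auto
  ultimately obtain a c where a: "a \<noteq> 0" "\<And>x. N x < 1 \<Longrightarrow> a \<bullet> x \<le> c" "c \<le> a \<bullet> m"
    using separating_hyperplane_sets[of "{x. N x < 1}" "{m}"] by auto
  have c0: "0 \<le> a \<bullet> m" using a(2)[of 0] a(3) N0 by simp
  have bound: "a \<bullet> x \<le> (a \<bullet> m) * N x" for x
  proof (rule field_le_epsilon)
    fix e :: real assume e: "0 < e"
    \<comment> \<open>Scaling by a factor slightly larger than \<open>N x\<close> moves \<open>x\<close> into the open ball.\<close>
    define t where "t = N x + e / (a \<bullet> m + 1)"
    have t: "t > N x" "t > 0" "(a \<bullet> m) * t \<le> (a \<bullet> m) * N x + e"
    proof -
      have pos: "e / (a \<bullet> m + 1) > 0" using e c0 by simp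
      show "t > N x" using pos by (simp add: t_def)
      show "t > 0" using pos N by (simp add: t_def is_norm_def add_nonneg_pos)
      have "(a \<bullet> m) * (e / (a \<bullet> m + 1)) \<le> e" using e c0 by (simp add: field_simps)
      then show "(a \<bullet> m) * t \<le> (a \<bullet> m) * N x + e" by (simp add: t_def algebra_simps)
    qed
    have "N (inverse t *\<^sub>R x) = inverse t * N x" using N t by (simp add: is_norm_def)
    also have "\<dots> < 1" using t by (simp add: field_simps)
    finally have "a \<bullet> (inverse t *\<^sub>R x) \<le> a \<bullet> m" using a by (meson order_trans)
    then have "a \<bullet> x \<le> (a \<bullet> m) * t" using t by (simp add: field_simps)
    then show "a \<bullet> x \<le> (a \<bullet> m) * N x + e" using t by linarith
  qed
  have "0 < a \<bullet> a" using a(1) by simp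
  then have "0 < (a \<bullet> m) * N a" using bound[of a] by (rule less_le_trans)
  then have "a \<bullet> m \<noteq> 0" by (metis less_irrefl mult_zero_left)
  with c0 have pos: "0 < a \<bullet> m" by simp
  show ?thesis
  proof (rule that[of "inverse (a \<bullet> m) *\<^sub>R a"])
    show "(inverse (a \<bullet> m) *\<^sub>R a) \<bullet> x \<le> N x" for x
      using bound[of x] pos by (simp add: field_simps)
    show "(inverse (a \<bullet> m) *\<^sub>R a) \<bullet> m = 1" using pos by simp
  qed
qed

text \<open>
  Suppose \<open>w \<bullet> a = - c\<close> with \<open>c > 0\<close>. Applying \<open>w\<close> to the relation gives
  \<open>B * (w \<bullet> b) = D + A * c\<close>, and the triangle inequality gives \<open>B \<le> D + A\<close>. Since \<open>c \<le> 1\<close>,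
  it follows that \<open>B * c \<le> B * (w \<bullet> b)\<close>.
\<close>
lemma support_sum_nonneg_of_cone_aux:
  fixes N :: "'a::real_inner \<Rightarrow> real"
  assumes N: "is_norm N" and unit: "N m = 1" "N a = 1" "N b = 1"
    and w: "\<And>x. w \<bullet> x \<le> N x" "w \<bullet> m = 1"
    and coeffs: "0 \<le> D" "0 \<le> A" "0 \<le> B" "A \<noteq> 0 \<or> B \<noteq> 0"
    and rel: "D *\<^sub>R m = A *\<^sub>R a + B *\<^sub>R b"
    and neg: "w \<bullet> a < 0"
  shows "0 \<le> w \<bullet> a + w \<bullet> b"
proof -
  define c where "c = - (w \<bullet> a)"
  have c: "0 < c" "c \<le> 1"
    using neg w(1)[of "- a"] unit is_norm_minus[OF N, of a] by (auto simp: c_def)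
  have "w \<bullet> (D *\<^sub>R m) = w \<bullet> (A *\<^sub>R a + B *\<^sub>R b)" using rel by simp
  then have eq: "B * (w \<bullet> b) = D + A * c"
    using w(2) by (simp add: inner_add_right c_def)
  have "B \<noteq> 0"
  proof
    assume "B = 0"
    then have "D + A * c = 0" using eq by simp
    moreover have "0 < A * c" using coeffs \<open>B = 0\<close> c by auto
    ultimately show False using coeffs by linarith
  qed
  then have B: "B > 0" using coeffs by simp
  have "B *\<^sub>R b = D *\<^sub>R m + (- A) *\<^sub>R a" using rel by (simp add: algebra_simps)
  then have "N (B *\<^sub>R b) \<le> N (D *\<^sub>R m) + N ((- A) *\<^sub>R a)"
    using N unfolding is_norm_def by metis
  moreover have "N (B *\<^sub>R b) = \<bar>B\<bar> * N b" "N (D *\<^sub>R m) = \<bar>D\<bar> * N m"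
    "N ((- A) *\<^sub>R a) = \<bar>- A\<bar> * N a"
    using N unfolding is_norm_def by blast+
  ultimately have "B \<le> D + A" using unit coeffs by simp
  then have "B * c \<le> (D + A) * c" using c by simp
  also have "\<dots> \<le> D + A * c" using c coeffs by (simp add: algebra_simps mult_left_le)
  finally have "B * c \<le> B * (w \<bullet> b)" using eq by simp
  then have "c \<le> w \<bullet> b" using B by simp
  then show ?thesis by (simp add: c_def)
qed

lemma support_sum_nonneg_of_cone:
  fixes N :: "'a::real_inner \<Rightarrow> real"
  assumes N: "is_norm N" and unit: "N m = 1" "N a = 1" "N b = 1"
    and w: "\<And>x. w \<bullet> x \<le> N x" "w \<bullet> m = 1"
    and coeffs: "0 \<le> D" "0 \<le> A" "0 \<le> B" "A \<noteq> 0 \<or> B \<noteq> 0"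
    and rel: "D *\<^sub>R m = A *\<^sub>R a + B *\<^sub>R b"
  shows "0 \<le> w \<bullet> a + w \<bullet> b"
proof -
  have rel': "D *\<^sub>R m = B *\<^sub>R b + A *\<^sub>R a" using rel by (simp add: add.commute)
  consider "w \<bullet> a < 0" | "w \<bullet> b < 0" | "0 \<le> w \<bullet> a" "0 \<le> w \<bullet> b" by linarith
  then show ?thesis
  proof cases
    case 1
    then show ?thesis
      using support_sum_nonneg_of_cone_aux[OF N unit w coeffs rel] by simp
  next
    case 2
    then show ?thesis
      using support_sum_nonneg_of_cone_aux[OF N unit(1,3,2) w coeffs(1,3,2) _ rel'] coeffs(4)
      by auto
  qed simp
qed

section \<open>Ordering a half-plane by direction\<close>

definition cross :: "real^2 \<Rightarrow> real^2 \<Rightarrow> real" where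
  "cross x y = x$1 * y$2 - x$2 * y$1"

text \<open>
  A monotone substitute for the angle in the half-plane \<open>u \<bullet> x \<ge> 0\<close>: a nonzero vector is scaled
  to the upper half of the \<open>\<ell>\<^sub>1\<close> unit circle in the coordinates
  \<open>(cross x u, u \<bullet> x)\<close>, and the first coordinate of the result is taken. Unlike the ratio of the
  coordinates, this stays finite on the boundary line, where it separates the two
  opposite directions.
\<close>
definition direction :: "real^2 \<Rightarrow> real^2 \<Rightarrow> real" where
  "direction u x = cross x u / (\<bar>cross x u\<bar> + u \<bullet> x)"

lemma cross_cramer: "cross a b *\<^sub>R m = cross m b *\<^sub>R a + cross a m *\<^sub>R b"
  unfolding cross_def by (simp add: vec_eq_iff forall_2 algebra_simps)

lemma cross_in_rotated_coordinates:
  "(u \<bullet> u) * cross a b = cross a u * (u \<bullet> b) - cross b u * (u \<bullet> a)"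
  unfolding cross_def by (simp add: inner_vec_def sum_2 algebra_simps)

lemma cross_eq_0_imp_scaled:
  assumes "cross a m = 0" "m \<noteq> 0"
  obtains t where "a = t *\<^sub>R m"
proof (cases "m$1 = 0")
  case True
  then have "m$2 \<noteq> 0" using assms by (simp add: vec_eq_iff forall_2)
  then have "a = (a$2 / m$2) *\<^sub>R m"
    using assms True by (simp add: vec_eq_iff forall_2 cross_def)
  then show ?thesis by (rule that)
next
  case False
  then have "a = (a$1 / m$1) *\<^sub>R m"
    using assms by (simp add: vec_eq_iff forall_2 cross_def field_simps)
  then show ?thesis by (rule that)
qed

lemma l1_coordinates_pos:
  assumes "u \<noteq> 0" "x \<noteq> 0" "0 \<le> u \<bullet> x"
  shows "0 < \<bar>cross x u\<bar> + u \<bullet> x"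
proof (rule ccontr)
  assume "\<not> ?thesis"
  then have z: "cross x u = 0" "u \<bullet> x = 0" using assms by linarith+
  obtain t where "x = t *\<^sub>R u" using cross_eq_0_imp_scaled[OF z(1) assms(1)] .
  then show False using z(2) assms by auto
qed

lemma cross_nonneg_of_direction_le:
  assumes u: "u \<noteq> 0" and a: "a \<noteq> 0" "0 \<le> u \<bullet> a" and b: "b \<noteq> 0" "0 \<le> u \<bullet> b"
    and le: "direction u b \<le> direction u a"
  shows "0 \<le> cross a b"
proof -
  define p q where "p = cross a u" and "q = cross b u"
  have pos: "0 < \<bar>p\<bar> + u \<bullet> a" "0 < \<bar>q\<bar> + u \<bullet> b"
    using l1_coordinates_pos[OF u a] l1_coordinates_pos[OF u b] by (simp_all add: p_def q_def)
  have le': "q * (\<bar>p\<bar> + u \<bullet> a) \<le> p * (\<bar>q\<bar> + u \<bullet> b)"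
    using le pos by (simp add: direction_def p_def q_def field_simps)
  have "0 \<le> p * (u \<bullet> b) - q * (u \<bullet> a)"
  proof (cases "0 \<le> p \<and> q \<le> 0")
    case True
    then have "0 \<le> p * (u \<bullet> b)" "q * (u \<bullet> a) \<le> 0"
      using a b by (auto intro: mult_nonpos_nonneg)
    then show ?thesis by linarith
  next
    case False
    \<comment> \<open>The absolute values can be cancelled from \<open>le'\<close>: both sides are equal here when the signs of
      \<open>p\<close> and \<open>q\<close> agree, and otherwise \<open>p < 0 \<le> q\<close>.\<close>
    have "p * \<bar>q\<bar> \<le> q * \<bar>p\<bar>"
    proof (cases "0 \<le> p")
      case True
      then show ?thesis using False by (simp add: abs_if)
    next
      case neg: False
      then show ?thesis by (cases "0 \<le> q") (auto simp: abs_if mult_nonneg_nonpos mult_nonpos_nonneg)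
    qed
    then show ?thesis using le' by (simp add: algebra_simps)
  qed
  then have "0 \<le> (u \<bullet> u) * cross a b"
    by (simp add: cross_in_rotated_coordinates p_def q_def)
  moreover have "0 < u \<bullet> u" using u by simp
  ultimately show ?thesis by (simp add: zero_le_mult_iff)
qed

lemma direction_minus_neq:
  assumes "u \<noteq> 0" "m \<noteq> 0" "0 \<le> u \<bullet> m" "0 \<le> u \<bullet> (- m)"
  shows "direction u (- m) \<noteq> direction u m"
proof -
  have 0: "u \<bullet> m = 0" using assms by simp
  have "cross m u \<noteq> 0" using l1_coordinates_pos[OF assms(1-3)] 0 by auto
  moreover have "cross (- m) u = - cross m u" by (simp add: cross_def)
  ultimately show ?thesis using 0 by (simp add: direction_def)
qed

text \<open>
  Cramer's rule provides the relation for \<open>support_sum_nonneg_of_cone\<close>, except when \<open>a\<close> and \<open>b\<close>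
  are both parallel to \<open>m\<close>. Then each is \<open>m\<close> or \<open>- m\<close>, and the only
  bad case \<open>a = b = - m\<close> would put \<open>m\<close> and \<open>- m\<close> in the same direction.
\<close>
lemma support_sum_nonneg_of_between:
  fixes N :: "real^2 \<Rightarrow> real"
  assumes N: "is_norm N" and unit: "N m = 1" "N a = 1" "N b = 1"
    and w: "\<And>x. w \<bullet> x \<le> N x" "w \<bullet> m = 1"
    and u: "u \<noteq> 0" "0 \<le> u \<bullet> m" "0 \<le> u \<bullet> a" "0 \<le> u \<bullet> b"
    and between: "direction u b \<le> direction u m" "direction u m \<le> direction u a"
  shows "0 \<le> w \<bullet> a + w \<bullet> b"
proof -
  have "N 0 = 0" using N by (simp add: is_norm_def)
  then have nz: "m \<noteq> 0" "a \<noteq> 0" "b \<noteq> 0" using unit by auto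
  have cross: "0 \<le> cross a b" "0 \<le> cross m b" "0 \<le> cross a m"
    using cross_nonneg_of_direction_le u nz between by (meson order_trans)+
  show ?thesis
  proof (cases "cross m b = 0 \<and> cross a m = 0")
    case False
    then show ?thesis
      using support_sum_nonneg_of_cone[OF N unit w cross _ cross_cramer] by auto
  next
    case True
    have par: "x = m \<or> x = - m" if x: "cross x m = 0" "N x = 1" for x
    proof -
      obtain t where t: "x = t *\<^sub>R m" using cross_eq_0_imp_scaled[OF x(1) nz(1)] .
      then have "\<bar>t\<bar> = 1" using x(2) unit(1) N by (simp add: is_norm_def)
      then show ?thesis using t by (auto simp: abs_if split: if_splits)
    qed
    have "cross b m = 0" using True by (simp add: cross_def algebra_simps)
    then have "a = m \<or> a = - m" "b = m \<or> b = - m" using par True unit by auto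
    moreover have "\<not> (a = - m \<and> b = - m)"
      using direction_minus_neq[OF u(1) nz(1) u(2)] u between by auto
    ultimately show ?thesis using w(2) by auto
  qed
qed

section \<open>The sum of an odd number of vectors in a half-plane\<close>

text \<open>
  Matching each position of the sorted list with its mirror image counts every vector twice and
  the middle one with itself, so that \<open>2 * (w \<bullet> s)\<close> is a sum of nonnegative terms, the middle one
  of which is \<open>2\<close>.
\<close>
lemma norm_sum_list_ge_1:
  fixes N :: "real^2 \<Rightarrow> real"
  assumes N: "is_norm N" and odd: "odd (length vs)"
    and unit: "\<And>x. x \<in> set vs \<Longrightarrow> N x = 1"
    and u: "u \<noteq> 0" "\<And>x. x \<in> set vs \<Longrightarrow> 0 \<le> u \<bullet> x"
  shows "1 \<le> N (sum_list vs)"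
proof -
  define xs where "xs = sort_key (direction u) vs"
  obtain k where k: "length xs = Suc (2 * k)"
    using odd by (auto simp: xs_def elim: oddE)
  have mem: "xs ! i \<in> set vs" if "i \<le> 2 * k" for i
    using nth_mem[of i xs] that k by (simp add: xs_def)
  have mono: "direction u (xs ! i) \<le> direction u (xs ! j)" if "i \<le> j" "j \<le> 2 * k" for i j
    using sorted_nth_mono[of "map (direction u) xs" i j] that k by (simp add: xs_def)
  define m where "m = xs ! k"
  have m: "N m = 1" "0 \<le> u \<bullet> m" using mem[of k] unit u by (auto simp: m_def)
  obtain w where w: "\<And>x. w \<bullet> x \<le> N x" "w \<bullet> m = 1"
    using supporting_functional_exists[OF N m(1)] by blast
  have pair: "0 \<le> w \<bullet> (xs ! i) + w \<bullet> (xs ! (2 * k - i))" if i: "i \<le> 2 * k" for i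
  proof -
    have half: "0 \<le> w \<bullet> (xs ! j) + w \<bullet> (xs ! l)" if "l \<le> k" "k \<le> j" "j \<le> 2 * k" for l j
      using support_sum_nonneg_of_between[OF N m(1) _ _ w u(1) m(2), of "xs ! j" "xs ! l"]
        mem[of j] mem[of l] mono[of l k] mono[of k j] unit u that by (auto simp: m_def)
    show ?thesis
    proof (cases "i \<le> k")
      case True
      then show ?thesis using half[of i "2 * k - i"] by (simp add: add.commute)
    next
      case False
      then show ?thesis using half[of "2 * k - i" i] i by simp
    qed
  qed
  have "sum_list vs = sum_list xs"
    unfolding xs_def by (metis mset_sort sum_mset_sum_list)
  also have "\<dots> = (\<Sum>i\<le>2 * k. xs ! i)"
    using k by (simp add: sum_list_sum_nth atLeast0LessThan lessThan_Suc_atMost)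
  finally have S: "w \<bullet> sum_list vs = (\<Sum>i\<le>2 * k. w \<bullet> (xs ! i))"
    by (simp add: inner_sum_right)
  have "(\<Sum>i\<le>2 * k. w \<bullet> (xs ! i)) = (\<Sum>i\<le>2 * k. w \<bullet> (xs ! (2 * k - i)))"
    by (rule sum.reindex_bij_witness[of _ "\<lambda>i. 2 * k - i" "\<lambda>i. 2 * k - i"]) auto
  then have "2 * (w \<bullet> sum_list vs) = (\<Sum>i\<le>2 * k. w \<bullet> (xs ! i) + w \<bullet> (xs ! (2 * k - i)))"
    using S by (simp add: sum.distrib)
  also have "\<dots> \<ge> w \<bullet> (xs ! k) + w \<bullet> (xs ! (2 * k - k))"
    by (rule member_le_sum) (use pair in auto)
  finally have "1 \<le> w \<bullet> sum_list vs" using w(2) by (simp add: m_def)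
  then show ?thesis using w(1) order_trans by blast
qed

theorem theorem1:
  fixes N :: "real^2 \<Rightarrow> real" and n :: nat and v :: "nat \<Rightarrow> real^2"
  assumes "is_norm N"
    and "n \<ge> 3" and "odd n"
    and "\<And>i. i \<in> {1..n} \<Longrightarrow> N (v i) = 1"
    and "\<exists>u::real^2. u \<noteq> 0 \<and> (\<forall>i\<in>{1..n}. u \<bullet> v i \<ge> 0)"
  shows "N (\<Sum>i=1..n. v i) \<ge> 1"
proof -
  obtain u :: "real^2" where u: "u \<noteq> 0" "\<And>i. i \<in> {1..n} \<Longrightarrow> 0 \<le> u \<bullet> v i"
    using assms(5) by blast
  have "(\<Sum>i=1..n. v i) = sum_list (map v [1..<Suc n])"
    by (simp add: sum_set_upt_conv_sum_list_nat[symmetric] atLeastLessThanSuc_atLeastAtMost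
        del: upt_Suc)
  moreover have "1 \<le> N (sum_list (map v [1..<Suc n]))"
    by (rule norm_sum_list_ge_1[OF assms(1) _ _ u(1)])
      (use assms(3,4) u(2) in \<open>auto simp: atLeastLessThanSuc_atLeastAtMost simp del: upt_Suc\<close>)
  ultimately show ?thesis by simp
qed

end
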